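(* Let $ns_1, ns_2$ be independent lenses into $\Sigma$ ($ns_1\bowtie ns_2$), let $\sigma,\rho:\Sigma\to\Sigma$, let $x:V\Rightarrow\Sigma$ be a lens and $v$ a $V$-valued expression over the state. Then: (1) $id[ns_1|ns_2]id = id$; (2) $\sigma[ns_1|ns_2]\rho = \rho[ns_2|ns_1]\sigma$; (3) if $x\preceq ns_1$ then $(\sigma(x\mapsto v))[ns_1|ns_2]\rho = (\sigma[ns_1|ns_2]\rho)(x\mapsto v)$; (4) if $x\bowtie ns_1$ then $(\sigma(x\mapsto v))[ns_1|ns_2]\rho = \sigma[ns_1|ns_2]\rho$.
   Context: A lens $X:V\Rightarrow\Sigma$ is a pair $get_X:\Sigma\to V$, $put_X:\Sigma\to V\to\Sigma$ with $get_X(put_X\,s\,v) = v$, $put_X(put_X\,s\,v')\,v = put_X\,s\,v$, and $put_X\,s\,(get_X\,s) = s$. Independence: $X\bowtie Y$ iff $put_X(put_Y\,s\,v)\,u = put_Y(put_X\,s\,u)\,v$ for all $s,u,v$. Sublens: $X\preceq Y$ (for $X:V\Rightarrow\Sigma$, $Y:W\Rightarrow\Sigma$) iff there is a lens $Z:V\Rightarrow W$ with $get_X = get_Z\circ get_Y$ and $put_X\,s\,u = put_Y\,s\,(put_Z\,(get_Y\,s)\,u)$. Override: $s_1\oplus_X s_2 = put_X\,s_1\,(get_X\,s_2)$. Substitution update: $\sigma(x\mapsto v) = \lambda s\bullet put_x\,(\sigma(s))\,(v(s))$; $id$ is the identity function on $\Sigma$. State-update merge: $(\sigma[ns_1|ns_2]\rho)(s)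 = (s\oplus_{ns_1}\sigma(s))\oplus_{ns_2}\rho(s)$. *)

theory Defs imports Main begin

record ('v, 's) lens =
  lens_get :: "'s \<Rightarrow> 'v"
  lens_put :: "'s \<Rightarrow> 'v \<Rightarrow> 's"

text \<open>The record only fixes the signature of a lens; \<open>is_lens\<close> adds the three laws.\<close>

definition is_lens :: "('v, 's) lens \<Rightarrow> bool" where
  "is_lens X \<longleftrightarrow>
     (\<forall>s v. lens_get X (lens_put X s v) = v) \<and>
     (\<forall>s v v'. lens_put X (lens_put X s v') v = lens_put X s v) \<and>
     (\<forall>s. lens_put X s (lens_get X s) = s)"

definition lens_indep :: "('u, 's) lens \<Rightarrow> ('v, 's) lens \<Rightarrow> bool" (infix "\<bowtie>" 50) where
  "X \<bowtie> Y \<longleftrightarrow>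
     (\<forall>s u v. lens_put X (lens_put Y s v) u = lens_put Y (lens_put X s u) v)"

definition sublens :: "('v, 's) lens \<Rightarrow> ('w, 's) lens \<Rightarrow> bool" (infix "\<preceq>" 50) where
  "X \<preceq> Y \<longleftrightarrow>
     (\<exists>Z :: ('v, 'w) lens. is_lens Z \<and>
        lens_get X = lens_get Z \<circ> lens_get Y \<and>
        (\<forall>s u. lens_put X s u = lens_put Y s (lens_put Z (lens_get Y s) u)))"

definition lens_override :: "'s \<Rightarrow> ('v, 's) lens \<Rightarrow> 's \<Rightarrow> 's" where
  "lens_override s1 X s2 = lens_put X s1 (lens_get X s2)"

definition subst_upd :: "('s \<Rightarrow> 's) \<Rightarrow> ('v, 's) lens \<Rightarrow> ('s \<Rightarrow> 'v) \<Rightarrow> ('s \<Rightarrow> 's)" where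
  "subst_upd \<sigma> x v = (\<lambda>s. lens_put x (\<sigma> s) (v s))"

text \<open>\<open>state_merge \<sigma> ns1 ns2 \<rho>\<close> stands for \<open>\<sigma> [ns1 | ns2] \<rho>\<close>: the \<open>ns1\<close> part of the final state
  comes from \<open>\<sigma>\<close>, the \<open>ns2\<close> part from \<open>\<rho>\<close>, and the rest from the initial state.\<close>

definition state_merge ::
  "('s \<Rightarrow> 's) \<Rightarrow> ('a, 's) lens \<Rightarrow> ('b, 's) lens \<Rightarrow> ('s \<Rightarrow> 's) \<Rightarrow> ('s \<Rightarrow> 's)" where
  "state_merge \<sigma> ns1 ns2 \<rho> =
     (\<lambda>s. lens_override (lens_override s ns1 (\<sigma> s)) ns2 (\<rho> s))"

end

theory Submission imports Defs begin

text \<open>Unfolded, the merge is two nested puts into the initial state \<open>s\<close>, and it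
  sees \<open>\<sigma>\<close> only through \<open>lens_get ns1 (\<sigma> s)\<close> and
  \<open>\<rho>\<close> only through \<open>lens_get ns2 (\<rho> s)\<close>. For \<open>id\<close>
  both puts write back what is already there; independence swaps the puts. An update of
  \<open>x\<close> therefore matters only by its effect on the \<open>ns1\<close> view: none if
  \<open>x \<bowtie> ns1\<close> (\<open>indep_get_put\<close>), and an update inside that view if
  \<open>x \<preceq> ns1\<close>.\<close>

context
  fixes X :: "('v, 's) lens"
  assumes lens: "is_lens X"
begin

lemma get_put: "lens_get X (lens_put X s v) = v"
  using lens by (simp add: is_lens_def)

lemma put_put: "lens_put X (lens_put X s v') v = lens_put X s v"
  using lens by (simp add: is_lens_def)

lemma put_get: "lens_put X s (lens_get X s) = s"
  using lens by (simp add: is_lens_def)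

end

lemma indep_put_comm:
  "X \<bowtie> Y \<Longrightarrow> lens_put X (lens_put Y s v) u = lens_put Y (lens_put X s u) v"
  by (simp add: lens_indep_def)

lemma indep_get_put:
  assumes "is_lens Y" and "X \<bowtie> Y"
  shows "lens_get Y (lens_put X s u) = lens_get Y s"
proof -
  \<comment> \<open>Write the current \<open>Y\<close> value back into \<open>s\<close>, which
    changes nothing, then commute this put past the one for \<open>X\<close>.\<close>
  have "lens_put X s u = lens_put Y (lens_put X s u) (lens_get Y s)"
    using indep_put_comm[OF assms(2)] put_get[OF assms(1)] by metis
  then show ?thesis
    using get_put[OF assms(1)] by metis
qed

lemma state_merge_id:
  assumes "is_lens ns1" and "is_lens ns2"
  shows "state_merge id ns1 ns2 id = id"
  by (simp add: state_merge_def lens_override_def fun_eq_iff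
      put_get[OF assms(1)] put_get[OF assms(2)])

lemma state_merge_commute:
  assumes "ns1 \<bowtie> ns2"
  shows "state_merge \<sigma> ns1 ns2 \<rho> = state_merge \<rho> ns2 ns1 \<sigma>"
  by (simp add: state_merge_def lens_override_def indep_put_comm[OF assms])

text \<open>With \<open>a = lens_get ns1 (\<sigma> s)\<close> and \<open>t\<close> the state after
  the \<open>ns2\<close> override, both sides reduce to
  \<open>lens_put ns1 t (lens_put Z a (v s))\<close>, where \<open>Z\<close> locates
  \<open>x\<close> within \<open>ns1\<close>.\<close>

lemma state_merge_subst_upd_sublens:
  fixes x :: "('v, 's) lens" and ns1 :: "('a, 's) lens"
  assumes "is_lens ns1" and "ns1 \<bowtie> ns2" and "x \<preceq> ns1"
  shows "state_merge (subst_upd \<sigma> x v) ns1 ns2 \<rho> = subst_upd (state_merge \<sigma> ns1 ns2 \<rho>) x v"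
proof -
  obtain Z :: "('v, 'a) lens"
    where "\<And>s u. lens_put x s u = lens_put ns1 s (lens_put Z (lens_get ns1 s) u)"
    using assms(3) unfolding sublens_def by blast
  then show ?thesis
    \<comment> \<open>Swapping makes the \<open>ns1\<close> put outermost, so that the update of
      \<open>x\<close>, itself an \<open>ns1\<close> put, meets it directly and
      \<open>get_put\<close> and \<open>put_put\<close> apply.\<close>
    unfolding state_merge_commute[OF assms(2)]
    by (simp add: state_merge_def lens_override_def subst_upd_def
        get_put[OF assms(1)] put_put[OF assms(1)])
qed

lemma state_merge_subst_upd_indep:
  assumes "is_lens ns1" and "x \<bowtie> ns1"
  shows "state_merge (subst_upd \<sigma> x v) ns1 ns2 \<rho> = state_merge \<sigma> ns1 ns2 \<rho>"
  by (simp add: state_merge_def lens_override_def subst_upd_def indep_get_put[OF assms])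

theorem theorem41:
  fixes ns1 :: "('a, 's) lens" and ns2 :: "('b, 's) lens"
    and \<sigma> \<rho> :: "'s \<Rightarrow> 's"
    and x :: "('v, 's) lens" and v :: "'s \<Rightarrow> 'v"
  assumes "is_lens ns1" and "is_lens ns2" and "ns1 \<bowtie> ns2"
    and "is_lens x"
  shows "state_merge id ns1 ns2 id = id \<and>
    state_merge \<sigma> ns1 ns2 \<rho> = state_merge \<rho> ns2 ns1 \<sigma> \<and>
    (x \<preceq> ns1 \<longrightarrow>
      state_merge (subst_upd \<sigma> x v) ns1 ns2 \<rho> = subst_upd (state_merge \<sigma> ns1 ns2 \<rho>) x v) \<and>
    (x \<bowtie> ns1 \<longrightarrow>
      state_merge (subst_upd \<sigma> x v) ns1 ns2 \<rho> = state_merge \<sigma> ns1 ns2 \<rho>)"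
  using assms state_merge_id state_merge_commute state_merge_subst_upd_sublens
    state_merge_subst_upd_indep by blast

end
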